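(* Let $G$ be a finite group and let $S=S^{-1}$ be a nonempty set generating $G$ with $e\notin S$. An admissible operator $T$ on $L^2(G)$ is $S$-local and $S$-uniform if and only if $T=c\mathcal{L}$ for some constant $c\in\mathbb{R}$.
   Context: $e$ is the identity of $G$. $L^2(G)$ is the space of functions $f:G\to\mathbb{C}$ with inner product $\langle f,h\rangle=\frac{1}{|G|}\sum_{g\in G}\overline{f(g)}h(g)$. A linear operator $T$ on $L^2(G)$ is admissible if it is Hermitian, commutes with all left translations $(L_af)(g)=f(a^{-1}g)$, annihilates the constant functions, and satisfies $\langle\overline{f},T\overline{f}\rangle=\langle f,Tf\rangle$ for every $f\in L^2(G)$. For $\varphi\in L^2(G)$, $(T_\varphi f)(g)=\sum_{h\in G}\varphi(g^{-1}h)f(h)$; every admissible operator equals $T_\varphi$ for a unique $\varphi$. An admissible $T=T_\varphi$ is $S$-local if the support of $\varphi$ is contained in $\{e\}\cup S$, and $S$-uniform if $\varphi$ is constant on $S$. The Laplacian is $\mathcal{L}=I-A$ with $(Af)(g)=\frac{1}{|S|}\sum_{s\in S}f(gs)$. *)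

theory Defs
  imports Complex_Main "HOL-Algebra.Generated_Groups"
begin

(* Functions on G are represented by functions on the whole type that vanish outside the
   carrier.  Thus L2 G is closed under the pointwise vector space operations, and equality of
   elements of L2 G is equality of functions on the carrier. *)
definition L2 :: "('a, 'b) monoid_scheme \<Rightarrow> ('a \<Rightarrow> complex) set" where
  "L2 G = {f. \<forall>g. g \<notin> carrier G \<longrightarrow> f g = 0}"

definition L2_inner ::
    "('a, 'b) monoid_scheme \<Rightarrow> ('a \<Rightarrow> complex) \<Rightarrow> ('a \<Rightarrow> complex) \<Rightarrow> complex" where
  "L2_inner G f h = (1 / of_nat (order G)) * (\<Sum>g\<in>carrier G. cnj (f g) * h g)"

definition left_translation ::
    "('a, 'b) monoid_scheme \<Rightarrow> 'a \<Rightarrow> ('a \<Rightarrow> complex) \<Rightarrow> ('a \<Rightarrow> complex)" where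
  "left_translation G a f =
     (\<lambda>g. if g \<in> carrier G then f (inv\<^bsub>G\<^esub> a \<otimes>\<^bsub>G\<^esub> g) else 0)"

definition const_fun :: "('a, 'b) monoid_scheme \<Rightarrow> complex \<Rightarrow> ('a \<Rightarrow> complex)" where
  "const_fun G c = (\<lambda>g. if g \<in> carrier G then c else 0)"

(* Only the restriction of T to L2 G is constrained. *)
definition linear_operator ::
    "('a, 'b) monoid_scheme \<Rightarrow> (('a \<Rightarrow> complex) \<Rightarrow> ('a \<Rightarrow> complex)) \<Rightarrow> bool" where
  "linear_operator G T \<longleftrightarrow>
     (\<forall>f\<in>L2 G. T f \<in> L2 G) \<and>
     (\<forall>f\<in>L2 G. \<forall>h\<in>L2 G. T (\<lambda>g. f g + h g) = (\<lambda>g. T f g + T h g)) \<and>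
     (\<forall>c. \<forall>f\<in>L2 G. T (\<lambda>g. c * f g) = (\<lambda>g. c * T f g))"

definition hermitian ::
    "('a, 'b) monoid_scheme \<Rightarrow> (('a \<Rightarrow> complex) \<Rightarrow> ('a \<Rightarrow> complex)) \<Rightarrow> bool" where
  "hermitian G T \<longleftrightarrow>
     (\<forall>f\<in>L2 G. \<forall>h\<in>L2 G. L2_inner G f (T h) = L2_inner G (T f) h)"

definition admissible ::
    "('a, 'b) monoid_scheme \<Rightarrow> (('a \<Rightarrow> complex) \<Rightarrow> ('a \<Rightarrow> complex)) \<Rightarrow> bool" where
  "admissible G T \<longleftrightarrow>
     linear_operator G T \<and>
     hermitian G T \<and>
     (\<forall>a\<in>carrier G. \<forall>f\<in>L2 G. T (left_translation G a f) = left_translation G a (T f)) \<and>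
     (\<forall>c. T (const_fun G c) = (\<lambda>_. 0)) \<and>
     (\<forall>f\<in>L2 G. L2_inner G (\<lambda>g. cnj (f g)) (T (\<lambda>g. cnj (f g))) = L2_inner G f (T f))"

definition kernel_operator ::
    "('a, 'b) monoid_scheme \<Rightarrow> ('a \<Rightarrow> complex) \<Rightarrow> ('a \<Rightarrow> complex) \<Rightarrow> ('a \<Rightarrow> complex)" where
  "kernel_operator G \<phi> f =
     (\<lambda>g. if g \<in> carrier G
           then \<Sum>h\<in>carrier G. \<phi> (inv\<^bsub>G\<^esub> g \<otimes>\<^bsub>G\<^esub> h) * f h else 0)"

definition has_kernel ::
    "('a, 'b) monoid_scheme \<Rightarrow> (('a \<Rightarrow> complex) \<Rightarrow> ('a \<Rightarrow> complex)) \<Rightarrow> ('a \<Rightarrow> complex) \<Rightarrow> bool" where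
  "has_kernel G T \<phi> \<longleftrightarrow> \<phi> \<in> L2 G \<and> (\<forall>f\<in>L2 G. T f = kernel_operator G \<phi> f)"

(* The existential quantifiers in S_local and S_uniform below therefore refer to the same
   kernel. *)
lemma has_kernel_unique:
  assumes "group G" "finite (carrier G)" "has_kernel G T \<phi>" "has_kernel G T \<psi>"
  shows "\<phi> = \<psi>"
proof
  interpret group G by fact
  fix x
  show "\<phi> x = \<psi> x"
  proof (cases "x \<in> carrier G")
    case True
    define d where "d = (\<lambda>h. if h = x then 1 else 0 :: complex)"
    have d: "d \<in> L2 G" using True by (auto simp: d_def L2_def)
    have eval: "T d \<one>\<^bsub>G\<^esub> = \<chi> x" if "has_kernel G T \<chi>" for \<chi>
    proof -
      have "T d \<one>\<^bsub>G\<^esub> = (\<Sum>h\<in>carrier G. \<chi> h * d h)"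
        using that d by (simp add: has_kernel_def kernel_operator_def)
      also have "\<dots> = (\<Sum>h\<in>carrier G. if h = x then \<chi> h else 0)"
        by (rule sum.cong) (auto simp: d_def)
      finally show ?thesis
        using True assms(2) by simp
    qed
    show ?thesis using eval[OF assms(3)] eval[OF assms(4)] by simp
  next
    case False
    then show ?thesis using assms(3,4) by (simp add: has_kernel_def L2_def)
  qed
qed

definition S_local ::
    "('a, 'b) monoid_scheme \<Rightarrow> 'a set \<Rightarrow> (('a \<Rightarrow> complex) \<Rightarrow> ('a \<Rightarrow> complex)) \<Rightarrow> bool" where
  "S_local G S T \<longleftrightarrow>
     (\<exists>\<phi>. has_kernel G T \<phi> \<and> {g \<in> carrier G. \<phi> g \<noteq> 0} \<subseteq> {\<one>\<^bsub>G\<^esub>} \<union> S)"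

definition S_uniform ::
    "('a, 'b) monoid_scheme \<Rightarrow> 'a set \<Rightarrow> (('a \<Rightarrow> complex) \<Rightarrow> ('a \<Rightarrow> complex)) \<Rightarrow> bool" where
  "S_uniform G S T \<longleftrightarrow> (\<exists>\<phi>. has_kernel G T \<phi> \<and> (\<exists>c. \<forall>s\<in>S. \<phi> s = c))"

definition averaging ::
    "('a, 'b) monoid_scheme \<Rightarrow> 'a set \<Rightarrow> ('a \<Rightarrow> complex) \<Rightarrow> ('a \<Rightarrow> complex)" where
  "averaging G S f =
     (\<lambda>g. if g \<in> carrier G
           then (1 / of_nat (card S)) * (\<Sum>s\<in>S. f (g \<otimes>\<^bsub>G\<^esub> s)) else 0)"

definition laplacian ::
    "('a, 'b) monoid_scheme \<Rightarrow> 'a set \<Rightarrow> ('a \<Rightarrow> complex) \<Rightarrow> ('a \<Rightarrow> complex)" where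
  "laplacian G S f = (\<lambda>g. f g - averaging G S f g)"

end

(* Writing the kernel operator as T f(g) = sum over x of phi(x) f(g x), locality and uniformity
   say that T = phi(e) I + k |S| A.  Annihilation of the constants forces phi(e) + k |S| = 0, so
   T = phi(e) (I - A), and Hermiticity tested on the point mass at e makes phi(e) real. *)
theory Submission
  imports Defs
begin

context group
begin

text \<open>Left multiplication by \<open>g\<close> permutes the group, so the substitution
  \<open>h = g \<otimes> x\<close> moves the dependence on \<open>g\<close> from the kernel to the
  argument of \<open>f\<close>.\<close>

lemma kernel_operator_eq_sum_right_translates:
  assumes "g \<in> carrier G"
  shows "kernel_operator G \<phi> f g = (\<Sum>x\<in>carrier G. \<phi> x * f (g \<otimes> x))"
  unfolding kernel_operator_def using assms
  by (auto intro!: sum.reindex_bij_witness[of _ "\<lambda>x. g \<otimes> x" "\<lambda>h. inv g \<otimes> h"]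
      simp: m_assoc[symmetric])

text \<open>The support condition cuts the sum over right translates down to
  \<open>insert \<one> S\<close>. As \<open>\<one>\<close> lies outside \<open>S\<close>, its term
  splits off, and \<open>k\<close> factors out of the rest. Both directions of the theorem rest on
  this formula.\<close>

lemma kernel_operator_local_uniform:
  assumes fin: "finite (carrier G)"
    and S: "S \<subseteq> carrier G" "\<one> \<notin> S"
    and supp: "{x \<in> carrier G. \<phi> x \<noteq> 0} \<subseteq> {\<one>} \<union> S"
    and const: "\<And>s. s \<in> S \<Longrightarrow> \<phi> s = k"
    and g: "g \<in> carrier G"
  shows "kernel_operator G \<phi> f g = \<phi> \<one> * f g + k * (\<Sum>s\<in>S. f (g \<otimes> s))"
proof -
  have "kernel_operator G \<phi> f g = (\<Sum>x\<in>carrier G. \<phi> x * f (g \<otimes> x))"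
    by (rule kernel_operator_eq_sum_right_translates[OF g])
  also have "\<dots> = (\<Sum>x\<in>insert \<one> S. \<phi> x * f (g \<otimes> x))"
    using fin S supp by (intro sum.mono_neutral_right) auto
  also have "\<dots> = \<phi> \<one> * f g + (\<Sum>s\<in>S. \<phi> s * f (g \<otimes> s))"
    using S g finite_subset[OF S(1) fin] by simp
  also have "(\<Sum>s\<in>S. \<phi> s * f (g \<otimes> s)) = k * (\<Sum>s\<in>S. f (g \<otimes> s))"
    by (simp add: const sum_distrib_left)
  finally show ?thesis .
qed

text \<open>For the point mass \<open>d\<close> at \<open>\<one>\<close>, the inner product of
  \<open>d\<close> with \<open>T d\<close> is \<open>\<phi> \<one>\<close> divided by the group
  order. Swapping the arguments conjugates it, so Hermiticity equates \<open>\<phi> \<one>\<close>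
  with its conjugate.\<close>

lemma hermitian_kernel_one_real:
  assumes fin: "finite (carrier G)"
    and "hermitian G T" and "has_kernel G T \<phi>"
  shows "\<phi> \<one> \<in> \<real>"
proof -
  define d where "d = (\<lambda>h. if h = \<one> then 1 else 0 :: complex)"
  have d: "d \<in> L2 G" by (auto simp: d_def L2_def)
  have "T d \<one> = (\<Sum>x\<in>carrier G. \<phi> x * d x)"
    using assms(3) d by (simp add: has_kernel_def kernel_operator_eq_sum_right_translates)
  also have "\<dots> = \<phi> \<one>"
    using fin by (simp add: d_def if_distrib cong: if_cong)
  finally have Td: "T d \<one> = \<phi> \<one>" .
  have "(\<Sum>g\<in>carrier G. cnj (d g) * T d g) = T d \<one>"
    using fin by (simp add: d_def if_distrib if_distribR cong: if_cong)
  moreover have "(\<Sum>g\<in>carrier G. cnj (T d g) * d g) = cnj (T d \<one>)"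
    using fin by (simp add: d_def if_distrib if_distribR cong: if_cong)
  moreover have "L2_inner G d (T d) = L2_inner G (T d) d"
    using assms(2) d by (simp add: hermitian_def)
  \<comment> \<open>This lets the normalising factor of \<open>L2_inner\<close> be
    cancelled.\<close>
  moreover have "order G \<noteq> 0"
    using fin order_gt_0_iff_finite by simp
  ultimately have "cnj (\<phi> \<one>) = \<phi> \<one>"
    by (simp add: L2_inner_def Td)
  then show ?thesis by (simp add: Reals_cnj_iff)
qed

end

theorem proposition8:
  fixes G :: "('a, 'b) monoid_scheme"
    and S :: "'a set"
    and T :: "('a \<Rightarrow> complex) \<Rightarrow> ('a \<Rightarrow> complex)"
  assumes "group G"
    and "finite (carrier G)"
    and "S \<subseteq> carrier G"
    and "S = set_inv\<^bsub>G\<^esub> S"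
    and "S \<noteq> {}"
    and "generate G S = carrier G"
    and "\<one>\<^bsub>G\<^esub> \<notin> S"
    and "admissible G T"
  shows "S_local G S T \<and> S_uniform G S T \<longleftrightarrow>
    (\<exists>c::real. \<forall>f\<in>L2 G. T f = (\<lambda>g. complex_of_real c * laplacian G S f g))"
proof -
  interpret group G by fact
  note fin = assms(2) and SG = assms(3) and oneS = assms(7)
  \<comment> \<open>Needed to solve for \<open>k\<close> below.\<close>
  have card: "of_nat (card S) \<noteq> (0::complex)"
    using assms(5) finite_subset[OF SG fin] by simp
  show ?thesis
  proof
    assume "S_local G S T \<and> S_uniform G S T"
    \<comment> \<open>Locality and uniformity each supply a kernel of their own; uniqueness
      identifies the two.\<close>
    then obtain \<phi> k where ker: "has_kernel G T \<phi>"
      and supp: "{g \<in> carrier G. \<phi> g \<noteq> 0} \<subseteq> {\<one>\<^bsub>G\<^esub>} \<union> S"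
      and const: "\<And>s. s \<in> S \<Longrightarrow> \<phi> s = k"
      unfolding S_local_def S_uniform_def
      using has_kernel_unique[OF assms(1) fin] by metis
    note apply_eq = kernel_operator_local_uniform[OF fin SG oneS supp const]
    have L2_1: "const_fun G 1 \<in> L2 G" by (simp add: L2_def const_fun_def)
    \<comment> \<open>One evaluation of \<open>T\<close> on a constant function gives the linear
      relation between \<open>\<phi> \<one>\<close> and \<open>k\<close>.\<close>
    have "0 = T (const_fun G 1) \<one>\<^bsub>G\<^esub>"
      using assms(8) by (simp add: admissible_def)
    also have "\<dots> = \<phi> \<one>\<^bsub>G\<^esub> * const_fun G 1 \<one>\<^bsub>G\<^esub>
        + k * (\<Sum>s\<in>S. const_fun G 1 (\<one>\<^bsub>G\<^esub> \<otimes>\<^bsub>G\<^esub> s))"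
      using ker L2_1 by (simp add: has_kernel_def apply_eq)
    also have "(\<Sum>s\<in>S. const_fun G 1 (\<one>\<^bsub>G\<^esub> \<otimes>\<^bsub>G\<^esub> s)) = (\<Sum>s\<in>S. 1)"
      using SG by (intro sum.cong) (auto simp: const_fun_def)
    finally have "\<phi> \<one>\<^bsub>G\<^esub> + k * of_nat (card S) = 0"
      by (simp add: const_fun_def)
    then have k: "k = - \<phi> \<one>\<^bsub>G\<^esub> / of_nat (card S)"
      using card by (simp add: field_simps eq_neg_iff_add_eq_0)
    obtain c :: real where c: "\<phi> \<one>\<^bsub>G\<^esub> = complex_of_real c"
      using hermitian_kernel_one_real[OF fin _ ker] assms(8)
      by (auto simp: admissible_def elim: Reals_cases)
    have "T f = (\<lambda>g. complex_of_real c * laplacian G S f g)" if f: "f \<in> L2 G" for f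
    proof
      fix g
      show "T f g = complex_of_real c * laplacian G S f g"
      proof (cases "g \<in> carrier G")
        case True
        then show ?thesis
          using ker f by (simp add: has_kernel_def apply_eq laplacian_def averaging_def c k
              right_diff_distrib)
      next
        \<comment> \<open>Off the carrier both sides take the default value 0, since
          \<open>f\<close> vanishes there.\<close>
        case False
        then show ?thesis
          using ker f by (simp add: has_kernel_def kernel_operator_def laplacian_def
              averaging_def L2_def)
      qed
    qed
    then show "\<exists>c::real. \<forall>f\<in>L2 G. T f = (\<lambda>g. complex_of_real c * laplacian G S f g)"
      by blast
  next
    assume "\<exists>c::real. \<forall>f\<in>L2 G. T f = (\<lambda>g. complex_of_real c * laplacian G S f g)"
    then obtain c :: real
      where c: "\<And>f. f \<in> L2 G \<Longrightarrow> T f = (\<lambda>g. complex_of_real c * laplacian G S f g)"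
      by blast
    \<comment> \<open>The weight that each right translate by an element of \<open>S\<close>
      receives in \<open>c\<close> times I - A.\<close>
    define k where "k = - complex_of_real c / of_nat (card S)"
    define \<phi> where "\<phi> = (\<lambda>g. if g = \<one>\<^bsub>G\<^esub> then complex_of_real c else if g \<in> S then k else 0)"
    have supp: "{g \<in> carrier G. \<phi> g \<noteq> 0} \<subseteq> {\<one>\<^bsub>G\<^esub>} \<union> S"
      by (auto simp: \<phi>_def)
    have const: "\<phi> s = k" if "s \<in> S" for s
      using that oneS by (auto simp: \<phi>_def)
    have one: "\<phi> \<one>\<^bsub>G\<^esub> = complex_of_real c" by (simp add: \<phi>_def)
    note apply_eq = kernel_operator_local_uniform[OF fin SG oneS supp const]
    have "T f g = kernel_operator G \<phi> f g" if f: "f \<in> L2 G" for f g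
    proof (cases "g \<in> carrier G")
      case True
      then show ?thesis
        using f by (simp add: c apply_eq laplacian_def averaging_def one k_def
            right_diff_distrib)
    next
      case False
      then show ?thesis
        using f by (simp add: c kernel_operator_def laplacian_def averaging_def L2_def)
    qed
    moreover have "\<phi> \<in> L2 G"
      using SG by (auto simp: \<phi>_def L2_def)
    ultimately have "has_kernel G T \<phi>"
      by (auto simp: has_kernel_def)
    \<comment> \<open>The same \<phi> witnesses both properties.\<close>
    then show "S_local G S T \<and> S_uniform G S T"
      unfolding S_local_def S_uniform_def using supp const by blast
  qed
qed

end
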